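(* Let $K$ be a field with $\mathrm{char}(K)\neq 2$ and let $(M,N,*,\partial,\{-,-\})$ be a braided crossed module of associative $K$-algebras. Then \[\{n,n'\}_{\mathfrak L}=\frac{\{n,n'\}-\{n',n\}}{2}\qquad (n,n'\in N)\] is a braiding on the crossed module of Lie $K$-algebras $(M^{\mathcal L},N^{\mathcal L},[-,-]_*,\partial)$.
   Context: Associative $K$-algebras are not necessarily unital. For an associative $K$-algebra $A$, $A^{\mathcal L}$ is the Lie algebra on the same vector space with bracket $[a,a']=aa'-a'a$. An associative action of $N$ on $M$ is a pair $*=( *_1,*_2)$ of $K$-bilinear maps $*_1\colon N\times M\to M$, $*_2\colon M\times N\to M$ such that for all $m,m'\in M$, $n,n'\in N$: $n*_1(mm')=(n*_1m)m'$, $n*_1(m*_2n')=(n*_1m)*_2n'$, $n*_1(n'*_1m)=(nn')*_1m$, $m*_2(nn')=(m*_2n)*_2n'$, $m(n*_1m')=(m*_2n)m'$, $m(m'*_2n)=(mm')*_2n$. Write $[n,m]_*=n*_1m-m*_2n$. A crossed module of associative $K$-algebras $(M,N,*,\partial)$ consists of associative algebras $M,N$, an associative action $*$ of $N$ on $M$ and a homomorphism $\partial\colon M\to N$ with $\partial(n*_1m)=n\partial(m)$, $\partial(m*_2n)=\partial(m)n$, $\partial(m)*_1m'=mm'=m*_2\partial(m')$. A braiding on it is a $K$-bilinear map $\{-,-\}\colon N\times N\to M$ such that for all $m,m'\in M$, $n,n',n''\in N$: $\partial\{n,n'\}=[n,n']$; $\{\partial m,\partial m'\}=[m,m']$; $\{\partial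 m,n\}=-[n,m]_*$; $\{n,\partial m\}=[n,m]_*$; $\{n,n'n''\}=n'*_1\{n,n''\}+\{n,n'\}*_2n''$; $\{nn',n''\}=n*_1\{n',n''\}+\{n,n''\}*_2n'$. Together these data form a braided crossed module of associative $K$-algebras. A Lie action of a Lie algebra $N$ on a Lie algebra $M$ is a $K$-bilinear map $\cdot\colon N\times M\to M$ with $[n,n']\cdot m=n\cdot(n'\cdot m)-n'\cdot(n\cdot m)$ and $n\cdot[m,m']=[n\cdot m,m']+[m,n\cdot m']$. A crossed module of Lie $K$-algebras $(M,N,\cdot,\partial)$ consists of Lie algebras $M,N$, a Lie action $\cdot$ of $N$ on $M$ and a Lie homomorphism $\partial\colon M\to N$ with $\partial(n\cdot m)=[n,\partial(m)]$ and $\partial(m)\cdot m'=[m,m']$. For a crossed module of associative algebras $(M,N,*,\partial)$, the tuple $(M^{\mathcal L},N^{\mathcal L},[-,-]_*,\partial)$ is a crossed module of Lie algebras. A braiding on a crossed module of Lie $K$-algebras $(M,N,\cdot,\partial)$ is a $K$-bilinear map $\{-,-\}\colon N\times N\to M$ such that for all $m,m'\in M$, $n,n',n''\in N$: $\partial\{n,n'\}=[n,n']$; $\{\partial m,\partial m'\}=[m,m']$; $\{\partial m,n\}=-n\cdot m$; $\{n,\partial m\}=n\cdot m$; $\{n,[n',n'']\}=\{[n,n'],n''\}-\{[n,n''],n'\}$; $\{[n,n'],n''\}=\{n,[n',n'']\}-\{n',[n,n'']\}$. *)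

theory Defs
  imports Complex_Main
begin

text \<open>
  A \<open>K\<close>-vector space is given by a type of class \<^class>\<open>ab_group_add\<close> together with an explicit
  scalar multiplication satisfying \<^locale>\<open>vector_space\<close>; products and brackets are
  explicit parameters, so one vector space can carry both its associative product
  and its commutator bracket.
\<close>

definition K_bilinear ::
  "('k::field \<Rightarrow> 'a::ab_group_add \<Rightarrow> 'a) \<Rightarrow> ('k \<Rightarrow> 'b::ab_group_add \<Rightarrow> 'b) \<Rightarrow>
   ('k \<Rightarrow> 'c::ab_group_add \<Rightarrow> 'c) \<Rightarrow> ('a \<Rightarrow> 'b \<Rightarrow> 'c) \<Rightarrow> bool"
  where "K_bilinear sA sB sC f \<longleftrightarrow>
    (\<forall>x. Vector_Spaces.linear sB sC (\<lambda>y. f x y)) \<and>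
    (\<forall>y. Vector_Spaces.linear sA sC (\<lambda>x. f x y))"

subsection \<open>Associative algebras\<close>

locale assoc_algebra = vector_space s
  for s :: "'k::field \<Rightarrow> 'a::ab_group_add \<Rightarrow> 'a" +
  fixes mult :: "'a \<Rightarrow> 'a \<Rightarrow> 'a"
  assumes mult_bilinear: "K_bilinear s s s mult"
    and mult_assoc: "mult (mult x y) z = mult x (mult y z)"

text \<open>The bracket of \<open>A\<^sup>\<L>\<close>.\<close>

definition commutator :: "('a::ab_group_add \<Rightarrow> 'a \<Rightarrow> 'a) \<Rightarrow> 'a \<Rightarrow> 'a \<Rightarrow> 'a"
  where "commutator mult x y = mult x y - mult y x"

locale assoc_action =
  M: assoc_algebra sM mM + N: assoc_algebra sN mN
  for sM :: "'k::field \<Rightarrow> 'm::ab_group_add \<Rightarrow> 'm" and mM :: "'m \<Rightarrow> 'm \<Rightarrow> 'm"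
    and sN :: "'k \<Rightarrow> 'n::ab_group_add \<Rightarrow> 'n" and mN :: "'n \<Rightarrow> 'n \<Rightarrow> 'n" +
  fixes act1 :: "'n \<Rightarrow> 'm \<Rightarrow> 'm" and act2 :: "'m \<Rightarrow> 'n \<Rightarrow> 'm"
  assumes act1_bilinear: "K_bilinear sN sM sM act1"
    and act2_bilinear: "K_bilinear sM sN sM act2"
    and act1_mult: "act1 n (mM m m') = mM (act1 n m) m'"
    and act1_act2: "act1 n (act2 m n') = act2 (act1 n m) n'"
    and act1_act1: "act1 n (act1 n' m) = act1 (mN n n') m"
    and act2_act2: "act2 m (mN n n') = act2 (act2 m n) n'"
    and mult_act1: "mM m (act1 n m') = mM (act2 m n) m'"
    and mult_act2: "mM m (act2 m' n) = act2 (mM m m') n"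

text \<open>The map \<open>[n, m]\<^sub>* = n *\<^sub>1 m - m *\<^sub>2 n\<close>.\<close>

definition action_commutator ::
  "('n \<Rightarrow> 'm::ab_group_add \<Rightarrow> 'm) \<Rightarrow> ('m \<Rightarrow> 'n \<Rightarrow> 'm) \<Rightarrow> 'n \<Rightarrow> 'm \<Rightarrow> 'm"
  where "action_commutator act1 act2 n m = act1 n m - act2 m n"

locale assoc_crossed_module = assoc_action sM mM sN mN act1 act2
  for sM :: "'k::field \<Rightarrow> 'm::ab_group_add \<Rightarrow> 'm" and mM :: "'m \<Rightarrow> 'm \<Rightarrow> 'm"
    and sN :: "'k \<Rightarrow> 'n::ab_group_add \<Rightarrow> 'n" and mN :: "'n \<Rightarrow> 'n \<Rightarrow> 'n"
    and act1 :: "'n \<Rightarrow> 'm \<Rightarrow> 'm" and act2 :: "'m \<Rightarrow> 'n \<Rightarrow> 'm" +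
  fixes bdry :: "'m \<Rightarrow> 'n"
  assumes bdry_linear: "Vector_Spaces.linear sM sN bdry"
    and bdry_mult: "bdry (mM m m') = mN (bdry m) (bdry m')"
    and bdry_act1: "bdry (act1 n m) = mN n (bdry m)"
    and bdry_act2: "bdry (act2 m n) = mN (bdry m) n"
    and peiffer1: "act1 (bdry m) m' = mM m m'"
    and peiffer2: "act2 m (bdry m') = mM m m'"

locale braided_assoc_crossed_module = assoc_crossed_module sM mM sN mN act1 act2 bdry
  for sM :: "'k::field \<Rightarrow> 'm::ab_group_add \<Rightarrow> 'm" and mM :: "'m \<Rightarrow> 'm \<Rightarrow> 'm"
    and sN :: "'k \<Rightarrow> 'n::ab_group_add \<Rightarrow> 'n" and mN :: "'n \<Rightarrow> 'n \<Rightarrow> 'n"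
    and act1 :: "'n \<Rightarrow> 'm \<Rightarrow> 'm" and act2 :: "'m \<Rightarrow> 'n \<Rightarrow> 'm"
    and bdry :: "'m \<Rightarrow> 'n" +
  fixes br :: "'n \<Rightarrow> 'n \<Rightarrow> 'm"
  assumes br_bilinear: "K_bilinear sN sN sM br"
    and bdry_br: "bdry (br n n') = commutator mN n n'"
    and br_bdry_bdry: "br (bdry m) (bdry m') = commutator mM m m'"
    and br_bdry_left: "br (bdry m) n = - action_commutator act1 act2 n m"
    and br_bdry_right: "br n (bdry m) = action_commutator act1 act2 n m"
    and br_mult_right: "br n (mN n' n'') = act1 n' (br n n'') + act2 (br n n') n''"
    and br_mult_left: "br (mN n n') n'' = act1 n (br n' n'') + act2 (br n n'') n'"

subsection \<open>Lie algebras\<close>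

locale lie_algebra = vector_space s
  for s :: "'k::field \<Rightarrow> 'a::ab_group_add \<Rightarrow> 'a" +
  fixes bracket :: "'a \<Rightarrow> 'a \<Rightarrow> 'a"
  assumes bracket_bilinear: "K_bilinear s s s bracket"
    and bracket_alternating: "bracket x x = 0"
    and jacobi: "bracket x (bracket y z) + bracket y (bracket z x) + bracket z (bracket x y) = 0"

locale lie_action =
  M: lie_algebra sM bM + N: lie_algebra sN bN
  for sM :: "'k::field \<Rightarrow> 'm::ab_group_add \<Rightarrow> 'm" and bM :: "'m \<Rightarrow> 'm \<Rightarrow> 'm"
    and sN :: "'k \<Rightarrow> 'n::ab_group_add \<Rightarrow> 'n" and bN :: "'n \<Rightarrow> 'n \<Rightarrow> 'n" +
  fixes act :: "'n \<Rightarrow> 'm \<Rightarrow> 'm"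
  assumes act_bilinear: "K_bilinear sN sM sM act"
    and act_bracket_left: "act (bN n n') m = act n (act n' m) - act n' (act n m)"
    and act_bracket_right: "act n (bM m m') = bM (act n m) m' + bM m (act n m')"

locale lie_crossed_module = lie_action sM bM sN bN act
  for sM :: "'k::field \<Rightarrow> 'm::ab_group_add \<Rightarrow> 'm" and bM :: "'m \<Rightarrow> 'm \<Rightarrow> 'm"
    and sN :: "'k \<Rightarrow> 'n::ab_group_add \<Rightarrow> 'n" and bN :: "'n \<Rightarrow> 'n \<Rightarrow> 'n"
    and act :: "'n \<Rightarrow> 'm \<Rightarrow> 'm" +
  fixes bdry :: "'m \<Rightarrow> 'n"
  assumes bdry_linear: "Vector_Spaces.linear sM sN bdry"
    and bdry_bracket: "bdry (bM m m') = bN (bdry m) (bdry m')"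
    and bdry_act: "bdry (act n m) = bN n (bdry m)"
    and peiffer: "act (bdry m) m' = bM m m'"

locale braided_lie_crossed_module = lie_crossed_module sM bM sN bN act bdry
  for sM :: "'k::field \<Rightarrow> 'm::ab_group_add \<Rightarrow> 'm" and bM :: "'m \<Rightarrow> 'm \<Rightarrow> 'm"
    and sN :: "'k \<Rightarrow> 'n::ab_group_add \<Rightarrow> 'n" and bN :: "'n \<Rightarrow> 'n \<Rightarrow> 'n"
    and act :: "'n \<Rightarrow> 'm \<Rightarrow> 'm" and bdry :: "'m \<Rightarrow> 'n" +
  fixes br :: "'n \<Rightarrow> 'n \<Rightarrow> 'm"
  assumes br_bilinear: "K_bilinear sN sN sM br"
    and bdry_br: "bdry (br n n') = bN n n'"
    and br_bdry_bdry: "br (bdry m) (bdry m') = bM m m'"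
    and br_bdry_left: "br (bdry m) n = - act n m"
    and br_bdry_right: "br n (bdry m) = act n m"
    and br_bracket_right: "br n (bN n' n'') = br (bN n n') n'' - br (bN n n'') n'"
    and br_bracket_left: "br (bN n n') n'' = br n (bN n' n'') - br n' (bN n n'')"

end

theory Submission
  imports Defs
begin

text \<open>
  The \<open>\<partial>\<close>-axioms give \<open>[n, {a, b}]\<^sub>* = {n, [a, b]} = - {[a, b], n}\<close>. Hence the
  antisymmetrisation \<open>D(a, b) = {a, b} - {b, a}\<close> satisfies \<open>[n, D(a, b)]\<^sub>* = D(n, [a, b])\<close>, and
  the associative braiding identities make \<open>D(n, _)\<close> a derivation:
  \<open>D(n, [a, b]) = [a, D(n, b)]\<^sub>* - [b, D(n, a)]\<^sub>* = D(a, [n, b]) - D(b, [n, a])\<close>.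
  Both Lie braiding identities are this formula, rearranged by antisymmetry of \<open>D\<close>.
\<close>

text \<open>\<open>Vector_Spaces.linear\<close> carries the vector space axioms along. Once these
  are assumed, only equations remain, and sums and multiples of bilinear maps can be checked by
  rewriting.\<close>

lemma K_bilinear_iff:
  assumes "vector_space sA" "vector_space sB" "vector_space sC"
  shows "K_bilinear sA sB sC f \<longleftrightarrow>
    (\<forall>x y z. f x (y + z) = f x y + f x z) \<and> (\<forall>x y z. f (x + y) z = f x z + f y z) \<and>
    (\<forall>c x y. f x (sB c y) = sC c (f x y)) \<and> (\<forall>c x y. f (sA c x) y = sC c (f x y))"
  using assms unfolding K_bilinear_def Vector_Spaces.linear_iff by blast

text \<open>Covers the terms with exchanged arguments: \<open>mult y x\<close> in a commutator, the
  right action in \<open>action_commutator\<close>, and \<open>br n' n\<close>.\<close>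

lemma K_bilinear_commute:
  "K_bilinear sA sB sC f \<Longrightarrow> K_bilinear sB sA sC (\<lambda>y x. f x y)"
  unfolding K_bilinear_def by blast

lemma K_bilinear_diff_fun:
  assumes "K_bilinear sA sB sC f" "K_bilinear sA sB sC g"
    and vs: "vector_space sA" "vector_space sB" "vector_space sC"
  shows "K_bilinear sA sB sC (\<lambda>x y. f x y - g x y)"
  using assms(1,2) unfolding K_bilinear_iff[OF vs]
  by (simp add: algebra_simps module.scale_right_diff_distrib[OF vs(3)[folded module_iff_vector_space]])

lemma K_bilinear_scale_fun:
  assumes "K_bilinear sA sB sC f"
    and vs: "vector_space sA" "vector_space sB" "vector_space sC"
  shows "K_bilinear sA sB sC (\<lambda>x y. sC c (f x y))"
  using assms(1) unfolding K_bilinear_iff[OF vs]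
  by (simp add: vector_space.vector_space_assms[OF vs(3)] mult.commute)

lemma K_bilinear_diff_left:
  "K_bilinear sA sB sC f \<Longrightarrow> f (x - y) z = f x z - f y z"
  unfolding K_bilinear_def using module_hom.diff[OF module_hom_linearI] by blast

lemma K_bilinear_diff_right:
  "K_bilinear sA sB sC f \<Longrightarrow> f x (y - z) = f x y - f x z"
  using K_bilinear_diff_left[OF K_bilinear_commute] .

context assoc_algebra
begin

lemmas mult_diff = K_bilinear_diff_left[OF mult_bilinear] K_bilinear_diff_right[OF mult_bilinear]

lemma lie_algebra_commutator: "lie_algebra s (commutator mult)"
proof unfold_locales
  show "K_bilinear s s s (commutator mult)"
    unfolding commutator_def[abs_def]
    by (intro K_bilinear_diff_fun mult_bilinear K_bilinear_commute[OF mult_bilinear]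
        vector_space_axioms)
qed (simp_all add: commutator_def mult_diff mult_assoc)

end

context assoc_action
begin

lemmas act_diff =
  K_bilinear_diff_left[OF act1_bilinear] K_bilinear_diff_right[OF act1_bilinear]
  K_bilinear_diff_left[OF act2_bilinear] K_bilinear_diff_right[OF act2_bilinear]

text \<open>For the action of a bracket, the mixed terms \<open>act1 n (act2 m n')\<close> cancel by
  \<open>act1_act2\<close>. For the derivation rule, the inner terms \<open>mM m (act1 n m')\<close>
  and \<open>mM (act2 m n) m'\<close> cancel by \<open>mult_act1\<close>.\<close>

lemma lie_action_commutator:
  "lie_action sM (commutator mM) sN (commutator mN) (action_commutator act1 act2)"
proof (intro lie_action.intro lie_action_axioms.intro
    M.lie_algebra_commutator N.lie_algebra_commutator)
  show "K_bilinear sN sM sM (action_commutator act1 act2)"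
    unfolding action_commutator_def[abs_def]
    by (intro K_bilinear_diff_fun act1_bilinear K_bilinear_commute[OF act2_bilinear]
        M.vector_space_axioms N.vector_space_axioms)
qed (simp_all add: commutator_def action_commutator_def act_diff M.mult_diff
    act1_mult act1_act2 act1_act1 act2_act2 mult_act1 mult_act2)

end

context assoc_crossed_module
begin

lemma bdry_diff: "bdry (x - y) = bdry x - bdry y"
  by (rule module_hom.diff[OF module_hom_linearI[OF bdry_linear]])

lemma bdry_scale: "bdry (sM c x) = sN c (bdry x)"
  by (rule module_hom.scale[OF module_hom_linearI[OF bdry_linear]])

lemma lie_crossed_module_commutator:
  "lie_crossed_module sM (commutator mM) sN (commutator mN) (action_commutator act1 act2) bdry"
  by (intro lie_crossed_module.intro lie_crossed_module_axioms.intro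
      lie_action_commutator bdry_linear)
    (simp_all add: commutator_def action_commutator_def bdry_diff bdry_mult bdry_act1 bdry_act2
      peiffer1 peiffer2)

end

text \<open>In the braiding axioms that involve the boundary, exchanging the arguments of
  \<open>br\<close> changes the sign of the value \<open>x\<close>. Antisymmetrising gives
  \<open>x - (- x)\<close>, and the factor 1/2 restores \<open>x\<close>.\<close>

lemma (in vector_space) scale_half_diff_uminus:
  assumes "(2::'a) \<noteq> 0"
  shows "scale (1 / 2) (x - (- x)) = x"
proof -
  have "x - (- x) = scale 2 x"
    by (metis diff_minus_eq_add one_add_one scale_left_distrib scale_one)
  then show ?thesis
    using assms by simp
qed

context braided_assoc_crossed_module
begin

abbreviation antisym_br :: "'n \<Rightarrow> 'n \<Rightarrow> 'm"
  where "antisym_br n n' \<equiv> br n n' - br n' n"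

lemma action_commutator_br:
  "action_commutator act1 act2 n (br a b) = br n (commutator mN a b)"
  "action_commutator act1 act2 n (br a b) = - br (commutator mN a b) n"
  by (simp_all add: br_bdry_right[symmetric] br_bdry_left bdry_br[symmetric])

lemma action_commutator_antisym_br:
  "action_commutator act1 act2 n (antisym_br a b) = antisym_br n (commutator mN a b)"
proof -
  have "action_commutator act1 act2 n (antisym_br a b)
      = action_commutator act1 act2 n (br a b) - action_commutator act1 act2 n (br b a)"
    by (simp add: action_commutator_def act_diff)
  \<comment> \<open>The bracket goes into the right slot for the first term and into the left slot
    for the second, so that both halves of \<open>antisym_br\<close> appear.\<close>
  also have "\<dots> = br n (commutator mN a b) + br (commutator mN b a) n"
    by (simp add: action_commutator_br(1)[of n a b] action_commutator_br(2)[of n b a])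
  also have "br (commutator mN b a) n = - br (commutator mN a b) n"
    by (simp add: commutator_def K_bilinear_diff_left[OF br_bilinear])
  finally show ?thesis by simp
qed

lemma antisym_br_commutator:
  "antisym_br n (commutator mN a b)
    = antisym_br a (commutator mN n b) - antisym_br b (commutator mN n a)"
proof -
  \<comment> \<open>Expanding products in the right slot gives
    \<open>[a, {n, b}]\<^sub>* - [b, {n, a}]\<^sub>*\<close>; in the left slot it gives the same
    with each inner braiding reversed. Their difference is the claim.\<close>
  have "antisym_br n (commutator mN a b)
      = action_commutator act1 act2 a (antisym_br n b)
        - action_commutator act1 act2 b (antisym_br n a)"
    by (simp add: commutator_def action_commutator_def act_diff br_mult_left br_mult_right
        K_bilinear_diff_left[OF br_bilinear] K_bilinear_diff_right[OF br_bilinear])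
  then show ?thesis
    by (simp only: action_commutator_antisym_br)
qed

lemma antisym_br_commutator':
  "antisym_br n (commutator mN a b)
    = antisym_br (commutator mN n a) b - antisym_br (commutator mN n b) a"
  unfolding antisym_br_commutator[of n] by simp

lemma antisym_br_commutator_left:
  "antisym_br (commutator mN a b) n
    = antisym_br a (commutator mN b n) - antisym_br b (commutator mN a n)"
proof -
  \<comment> \<open>The formula is taken with \<open>a\<close>, \<open>b\<close>, \<open>n\<close>
    in the roles of \<open>n\<close>, \<open>a\<close>, \<open>b\<close> and then solved for its
    last term.\<close>
  have "antisym_br a (commutator mN b n)
      = antisym_br b (commutator mN a n) - antisym_br n (commutator mN a b)"
    by (rule antisym_br_commutator)
  then show ?thesis by (simp add: algebra_simps)
qed

lemma braided_lie_crossed_module_commutator: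
  assumes two: "(2::'k) \<noteq> 0"
  shows "braided_lie_crossed_module sM (commutator mM) sN (commutator mN)
    (action_commutator act1 act2) bdry (\<lambda>n n'. sM (1 / 2) (antisym_br n n'))"
proof (intro braided_lie_crossed_module.intro braided_lie_crossed_module_axioms.intro
    lie_crossed_module_commutator)
  show "K_bilinear sN sN sM (\<lambda>n n'. sM (1 / 2) (antisym_br n n'))"
    by (intro K_bilinear_scale_fun K_bilinear_diff_fun br_bilinear
        K_bilinear_commute[OF br_bilinear] M.vector_space_axioms N.vector_space_axioms)
next
  fix n n' :: 'n
  have "commutator mN n' n = - commutator mN n n'"
    by (simp add: commutator_def)
  then show "bdry (sM (1 / 2) (antisym_br n n')) = commutator mN n n'"
    by (simp only: bdry_scale bdry_diff bdry_br N.scale_half_diff_uminus[OF two])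
next
  fix m m' :: 'm
  have "commutator mM m' m = - commutator mM m m'"
    by (simp add: commutator_def)
  then show "sM (1 / 2) (antisym_br (bdry m) (bdry m')) = commutator mM m m'"
    by (simp only: br_bdry_bdry M.scale_half_diff_uminus[OF two])
next
  fix m :: 'm and n :: 'n
  show "sM (1 / 2) (antisym_br n (bdry m)) = action_commutator act1 act2 n m"
    by (simp only: br_bdry_left br_bdry_right M.scale_half_diff_uminus[OF two])
  show "sM (1 / 2) (antisym_br (bdry m) n) = - action_commutator act1 act2 n m"
    \<comment> \<open>Here \<open>x\<close> is itself negative, so the double negation in
      \<open>x - (- x)\<close> has to be removed to match.\<close>
    using M.scale_half_diff_uminus[OF two, of "- action_commutator act1 act2 n m"]
    by (simp only: br_bdry_left br_bdry_right minus_minus)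
next
  fix n n' n'' :: 'n
  \<comment> \<open>Both remaining identities are linear in the braiding, so the factor 1/2 passes
    through them.\<close>
  show "sM (1 / 2) (antisym_br n (commutator mN n' n''))
      = sM (1 / 2) (antisym_br (commutator mN n n') n'')
        - sM (1 / 2) (antisym_br (commutator mN n n'') n')"
    by (simp only: antisym_br_commutator'[of n] M.scale_right_diff_distrib)
  show "sM (1 / 2) (antisym_br (commutator mN n n') n'')
      = sM (1 / 2) (antisym_br n (commutator mN n' n''))
        - sM (1 / 2) (antisym_br n' (commutator mN n n''))"
    by (simp only: antisym_br_commutator_left[of n] M.scale_right_diff_distrib)
qed

end

lemma two_neq_zero_if_CHAR_neq_2:
  assumes "CHAR('a::idom) \<noteq> 2"
  shows "(2::'a) \<noteq> 0"
proof
  assume "(2::'a) = 0"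
  then have "CHAR('a) = 2"
    \<comment> \<open>The only smaller positive integer is 1, which is nonzero in a domain.\<close>
    by (intro CHAR_eq_posI) (auto simp: less_2_cases_iff)
  with assms show False ..
qed

theorem proposition4p10:
  fixes sM :: "'k::field \<Rightarrow> 'm::ab_group_add \<Rightarrow> 'm" and mM :: "'m \<Rightarrow> 'm \<Rightarrow> 'm"
    and sN :: "'k \<Rightarrow> 'n::ab_group_add \<Rightarrow> 'n" and mN :: "'n \<Rightarrow> 'n \<Rightarrow> 'n"
    and act1 :: "'n \<Rightarrow> 'm \<Rightarrow> 'm" and act2 :: "'m \<Rightarrow> 'n \<Rightarrow> 'm"
    and bdry :: "'m \<Rightarrow> 'n" and br :: "'n \<Rightarrow> 'n \<Rightarrow> 'm"
  assumes "CHAR('k) \<noteq> 2"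
    and "braided_assoc_crossed_module sM mM sN mN act1 act2 bdry br"
  shows "braided_lie_crossed_module sM (commutator mM) sN (commutator mN)
    (action_commutator act1 act2) bdry (\<lambda>n n'. sM (1 / 2) (br n n' - br n' n))"
  using braided_assoc_crossed_module.braided_lie_crossed_module_commutator[OF assms(2)]
    two_neq_zero_if_CHAR_neq_2[OF assms(1)] .

end
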